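(* Let $S$ be a cancellative semigroup and suppose that its reduced abelianization $S_{\mathrm{rab}}$ is also cancellative. The following statements are equivalent. (1) If $a,b\in S$ are such that $a\equiv_p b$ and $a\simeq u_1\cdots u_m$ with $m\in\mathbb N_0$ and $u_1,\dots,u_m\in\mathcal A(S)$, then there exist $v_1,\dots,v_m\in\mathcal A(S)$ and a permutation $\sigma\in\mathfrak S_m$ such that $b\simeq v_1\cdots v_m$ and $u_i\simeq v_{\sigma(i)}$ for all $i\in[1,m]$. (2) The canonical homomorphism $\pi\colon S\to S_{\mathrm{rab}}$ is a weak transfer homomorphism. (3) The canonical homomorphism $\pi\colon S\to S_{\mathrm{rab}}$ is an isoatomic weak transfer homomorphism. Moreover, each of (1), (2), (3) implies the following three (mutually equivalent) conditions: $\equiv_p$ is transitive; $\equiv_p$ is a congruence relation; $\equiv_p$ coincides with $\equiv_{\mathrm{rab}}$.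
   Context: Semigroups have a neutral element. $S^\times$ is the group of units; $a\simeq b$ (associated) if $b=\varepsilon a\eta$ with $\varepsilon,\eta\in S^\times$. An atom is a non-unit $u$ such that $u=ab$ implies $a$ or $b$ is a unit; $\mathcal A(S)$ is the set of atoms; a cancellative semigroup is atomic if every non-unit is a finite product of atoms. $[1,m]$ is the set of integers from $1$ to $m$, and $\mathfrak S_m$ is the group of permutations of $[1,m]$; the empty product is $1$. Let $\equiv_{\mathrm{ab}}$ be the smallest congruence on $S$ with $ab\equiv_{\mathrm{ab}}ba$ for all $a,b\in S$, and $S_{\mathrm{ab}}=S/{\equiv_{\mathrm{ab}}}$. The reduced abelianization $S_{\mathrm{rab}}$ is the quotient of the commutative semigroup $S_{\mathrm{ab}}$ by associativity $\simeq$ (a congruence there), together with the canonical homomorphism $\pi\colon S\to S_{\mathrm{rab}}$; $\equiv_{\mathrm{rab}}$ is the corresponding congruence on $S$ ($a\equiv_{\mathrm{rab}}b$ iff $\pi(a)=\pi(b)$). The relation $\equiv_p$ on $S$: $a\equiv_p b$ iff there are $m\in\mathbb N_0$, $a_1,\dots,a_m,b_1,\dots,b_m\in S$ and $\sigma\in\mathfrak S_m$ with $a\simeq a_1\cdots a_m$, $b\simeq b_1\cdots b_m$ and $a_i\simeq b_{\sigma(i)}$ for all $i\in[1,m]$. For cancellative semigroups $S,T$ with $T$ atomic, a homomorphism $\phi\colon S\to T$ is a weak transfer homomorphism if (T1) $T=T^\times\phi(S)T^\times$ and $\phi^{-1}(T^\times)=S^\times$, and (WT2) whenever $a\in S$,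 $n\in\mathbb N$, $v_1,\dots,v_n\in\mathcal A(T)$ and $\phi(a)=v_1\cdots v_n$, there are $u_1,\dots,u_n\in\mathcal A(S)$ and $\sigma\in\mathfrak S_n$ with $a=u_1\cdots u_n$ and $\phi(u_i)\simeq v_{\sigma(i)}$ for all $i\in[1,n]$. A homomorphism $\phi\colon S\to T$ of cancellative semigroups is isoatomic if $\phi(u)\simeq\phi(v)$ implies $u\simeq v$ for all $u,v\in\mathcal A(S)$.
   Formalization: The equivalence of (1), (2), (3) and their implying the conditions on ≡_p are proved assuming S_rab is atomic, as weak transfer homomorphisms require; without this (1)⇒(2) fails for the nonnegative reals under addition. The last three conditions are shown equivalent without it. *)

theory Defs
  imports "HOL-Algebra.Divisibility" "HOL-Combinatorics.Permutations"
begin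

text \<open>
  The semigroups with neutral element of the source are HOL-Algebra monoids. No commutativity is
  assumed, so the notions of HOL-Algebra.Divisibility that are based on one-sided divisibility
  (associated, irreducible, ...) are not used; only the locale \<^term>\<open>monoid_cancel\<close>
  (left and right cancellation) is.
\<close>

text \<open>
  Finite sequences \<open>a\<^sub>1, \<dots>, a\<^sub>m\<close> are lists, indexed from 0; permutations of \<open>[1,m]\<close> become
  functions \<open>\<sigma>\<close> with \<open>\<sigma> permutes {..<m}\<close>.
\<close>

definition list_prod :: "('a, 'b) monoid_scheme \<Rightarrow> 'a list \<Rightarrow> 'a" where
  "list_prod S xs = foldr (mult S) xs (one S)"

definition assoc_rel :: "('a, 'b) monoid_scheme \<Rightarrow> ('a \<times> 'a) set" where
  "assoc_rel S = {(a, b). a \<in> carrier S \<and> b \<in> carrier S \<and>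
     (\<exists>\<epsilon>\<in>Units S. \<exists>\<eta>\<in>Units S. b = \<epsilon> \<otimes>\<^bsub>S\<^esub> a \<otimes>\<^bsub>S\<^esub> \<eta>)}"

definition atoms :: "('a, 'b) monoid_scheme \<Rightarrow> 'a set" where
  "atoms S = {u \<in> carrier S - Units S.
     \<forall>a\<in>carrier S. \<forall>b\<in>carrier S. u = a \<otimes>\<^bsub>S\<^esub> b \<longrightarrow> a \<in> Units S \<or> b \<in> Units S}"

definition atomic :: "('a, 'b) monoid_scheme \<Rightarrow> bool" where
  "atomic S \<longleftrightarrow>
     (\<forall>a\<in>carrier S - Units S. \<exists>us. set us \<subseteq> atoms S \<and> a = list_prod S us)"

definition monoid_congruence :: "('a, 'b) monoid_scheme \<Rightarrow> ('a \<times> 'a) set \<Rightarrow> bool" where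
  "monoid_congruence S r \<longleftrightarrow> equiv (carrier S) r \<and>
     (\<forall>a b c d. (a, b) \<in> r \<longrightarrow> (c, d) \<in> r \<longrightarrow> (a \<otimes>\<^bsub>S\<^esub> c, b \<otimes>\<^bsub>S\<^esub> d) \<in> r)"

text \<open>Only meaningful when the relation is a congruence.\<close>

definition quot_monoid :: "('a, 'b) monoid_scheme \<Rightarrow> ('a \<times> 'a) set \<Rightarrow> 'a set monoid" where
  "quot_monoid S r = \<lparr>carrier = carrier S // r,
     mult = (\<lambda>A B. \<Union>a\<in>A. \<Union>b\<in>B. r `` {a \<otimes>\<^bsub>S\<^esub> b}),
     one = r `` {\<one>\<^bsub>S\<^esub>}\<rparr>"

text \<open>The smallest congruence identifying all \<open>ab\<close> and \<open>ba\<close>, as an intersection.\<close>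

definition ab_rel :: "('a, 'b) monoid_scheme \<Rightarrow> ('a \<times> 'a) set" where
  "ab_rel S = \<Inter>{r. monoid_congruence S r \<and>
     (\<forall>a\<in>carrier S. \<forall>b\<in>carrier S. (a \<otimes>\<^bsub>S\<^esub> b, b \<otimes>\<^bsub>S\<^esub> a) \<in> r)}"

definition ab_monoid :: "('a, 'b) monoid_scheme \<Rightarrow> 'a set monoid" where
  "ab_monoid S = quot_monoid S (ab_rel S)"

definition rab_monoid :: "('a, 'b) monoid_scheme \<Rightarrow> 'a set set monoid" where
  "rab_monoid S = quot_monoid (ab_monoid S) (assoc_rel (ab_monoid S))"

definition rab_proj :: "('a, 'b) monoid_scheme \<Rightarrow> 'a \<Rightarrow> 'a set set" where
  "rab_proj S a = assoc_rel (ab_monoid S) `` {ab_rel S `` {a}}"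

definition rab_rel :: "('a, 'b) monoid_scheme \<Rightarrow> ('a \<times> 'a) set" where
  "rab_rel S = {(a, b). a \<in> carrier S \<and> b \<in> carrier S \<and> rab_proj S a = rab_proj S b}"

text \<open>The relation \<open>\<equiv>\<^sub>p\<close>.\<close>

definition perm_rel :: "('a, 'b) monoid_scheme \<Rightarrow> ('a \<times> 'a) set" where
  "perm_rel S = {(a, b). a \<in> carrier S \<and> b \<in> carrier S \<and>
     (\<exists>as bs \<sigma>. set as \<subseteq> carrier S \<and> set bs \<subseteq> carrier S \<and>
        length bs = length as \<and> \<sigma> permutes {..<length as} \<and>
        (a, list_prod S as) \<in> assoc_rel S \<and> (b, list_prod S bs) \<in> assoc_rel S \<and>
        (\<forall>i<length as. (as ! i, bs ! \<sigma> i) \<in> assoc_rel S))}"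

text \<open>
  The library's \<^term>\<open>hom\<close> does not require preservation of the neutral element, hence the extra
  condition.
\<close>

definition monoid_hom :: "('a, 'c) monoid_scheme \<Rightarrow> ('b, 'd) monoid_scheme \<Rightarrow> ('a \<Rightarrow> 'b) \<Rightarrow> bool"
  where
  "monoid_hom S T \<phi> \<longleftrightarrow> \<phi> \<in> hom S T \<and> \<phi> \<one>\<^bsub>S\<^esub> = \<one>\<^bsub>T\<^esub>"

text \<open>
  In (WT2), the last conjunct, the number of factors is positive; for the empty product the
  condition would force \<open>S\<close> to be reduced.
\<close>

definition weak_transfer_hom ::
  "('a, 'c) monoid_scheme \<Rightarrow> ('b, 'd) monoid_scheme \<Rightarrow> ('a \<Rightarrow> 'b) \<Rightarrow> bool" where
  "weak_transfer_hom S T \<phi> \<longleftrightarrow>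
     monoid_cancel S \<and> monoid_cancel T \<and> atomic T \<and> monoid_hom S T \<phi> \<and>
     carrier T = {\<epsilon> \<otimes>\<^bsub>T\<^esub> \<phi> s \<otimes>\<^bsub>T\<^esub> \<eta> | \<epsilon> s \<eta>. \<epsilon> \<in> Units T \<and> s \<in> carrier S \<and> \<eta> \<in> Units T} \<and>
     {a \<in> carrier S. \<phi> a \<in> Units T} = Units S \<and>
     (\<forall>a\<in>carrier S. \<forall>vs. vs \<noteq> [] \<and> set vs \<subseteq> atoms T \<and> \<phi> a = list_prod T vs \<longrightarrow>
        (\<exists>us \<sigma>. length us = length vs \<and> set us \<subseteq> atoms S \<and> \<sigma> permutes {..<length vs} \<and>
           a = list_prod S us \<and>
           (\<forall>i<length vs. (\<phi> (us ! i), vs ! \<sigma> i) \<in> assoc_rel T)))"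

definition isoatomic ::
  "('a, 'c) monoid_scheme \<Rightarrow> ('b, 'd) monoid_scheme \<Rightarrow> ('a \<Rightarrow> 'b) \<Rightarrow> bool" where
  "isoatomic S T \<phi> \<longleftrightarrow>
     monoid_cancel S \<and> monoid_cancel T \<and> monoid_hom S T \<phi> \<and>
     (\<forall>u\<in>atoms S. \<forall>v\<in>atoms S. (\<phi> u, \<phi> v) \<in> assoc_rel T \<longrightarrow> (u, v) \<in> assoc_rel S)"

end

theory Submission
  imports Defs
begin

text \<open>
  The congruence \<open>\<equiv>\<^sub>r\<^sub>a\<^sub>b\<close> is the least congruence that contains associativity and all pairs
  \<open>(ab, ba)\<close>, and \<open>\<equiv>\<^sub>p\<close> is reflexive, symmetric, compatible with multiplication and
  contains these pairs; hence \<open>\<equiv>\<^sub>r\<^sub>a\<^sub>b\<close> is the transitive closure of \<open>\<equiv>\<^sub>p\<close>, which gives the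
  equivalence of the last three conditions. By the same minimality, \<open>\<equiv>\<^sub>r\<^sub>a\<^sub>b\<close> preserves units and
  the associativity class of an atom, since these properties define such a congruence. So \<open>\<pi>\<close>
  reflects units and atoms and is always isoatomic. Condition (1) then transports factorizations along
  chains of \<open>\<equiv>\<^sub>p\<close>-steps, i.e. along \<open>\<equiv>\<^sub>r\<^sub>a\<^sub>b\<close>, which is the weak transfer property.
\<close>

section \<open>Sequences compared up to order, and congruences\<close>

text \<open>Rearranging the pairs so that the left list becomes \<open>xs\<close> leaves on the
  right a rearrangement of \<open>ys\<close>, which is the permutation. With this bridge the proof
  works with \<open>rel_mset\<close>, which is known to be closed under flips and composition, and
  permutations appear only where the definitions mention them.\<close>

lemma rel_mset_iff_permutes:
  "rel_mset R (mset xs) (mset ys) \<longleftrightarrow>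
     length ys = length xs \<and> (\<exists>\<sigma>. \<sigma> permutes {..<length xs} \<and> (\<forall>i<length xs. R (xs ! i) (ys ! \<sigma> i)))"
proof
  assume "rel_mset R (mset xs) (mset ys)"
  then obtain xs' ys' where "mset xs' = mset xs" "mset ys' = mset ys" "list_all2 R xs' ys'"
    unfolding rel_mset_def by blast
  then obtain zs where zs: "list_all2 R xs zs" "mset zs = mset ys"
    by (metis list_all2_reorder_left_invariance)
  then obtain \<sigma> where s: "\<sigma> permutes {..<length ys}" "permute_list \<sigma> ys = zs"
    by (metis mset_eq_permutation)
  have "length ys = length xs"
    using zs by (metis list_all2_lengthD mset_eq_length)
  then show "length ys = length xs \<and>
    (\<exists>\<sigma>. \<sigma> permutes {..<length xs} \<and> (\<forall>i<length xs. R (xs ! i) (ys ! \<sigma> i)))"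
    using s zs(1) by (auto intro!: exI[of _ \<sigma>] simp: list_all2_conv_all_nth permute_list_nth)
next
  assume "length ys = length xs \<and>
    (\<exists>\<sigma>. \<sigma> permutes {..<length xs} \<and> (\<forall>i<length xs. R (xs ! i) (ys ! \<sigma> i)))"
  then obtain \<sigma> where s: "length ys = length xs" "\<sigma> permutes {..<length ys}"
    "\<forall>i<length xs. R (xs ! i) (ys ! \<sigma> i)" by auto
  then have "list_all2 R xs (permute_list \<sigma> ys)"
    by (auto simp: list_all2_conv_all_nth permute_list_nth)
  then show "rel_mset R (mset xs) (mset ys)"
    unfolding rel_mset_def using mset_permute_list[OF s(2)] by blast
qed

lemma rel_mset_add:
  assumes "rel_mset R M N" "rel_mset R M' N'"
  shows "rel_mset R (M + M') (N + N')"
proof -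
  obtain xs ys xs' ys' where
    "mset xs = M" "mset ys = N" "list_all2 R xs ys" "mset xs' = M'" "mset ys' = N'" "list_all2 R xs' ys'"
    using assms unfolding rel_mset_def by blast
  then show ?thesis
    unfolding rel_mset_def by (metis list_all2_appendI mset_append)
qed

lemma monoid_congruenceD:
  assumes "monoid_congruence S r"
  shows "refl_on (carrier S) r" "sym r" "trans r" "r \<subseteq> carrier S \<times> carrier S"
    "\<And>a b c d. (a, b) \<in> r \<Longrightarrow> (c, d) \<in> r \<Longrightarrow> (a \<otimes>\<^bsub>S\<^esub> c, b \<otimes>\<^bsub>S\<^esub> d) \<in> r"
  using assms unfolding monoid_congruence_def equiv_def refl_on_def by auto

section \<open>Products, associativity and atoms in a monoid\<close>

context monoid
begin

lemma list_prod_Nil [simp]: "list_prod G [] = \<one>"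
  and list_prod_Cons [simp]: "list_prod G (x # xs) = x \<otimes> list_prod G xs"
  by (simp_all add: list_prod_def)

lemma list_prod_closed [simp]: "set xs \<subseteq> carrier G \<Longrightarrow> list_prod G xs \<in> carrier G"
  by (induction xs) auto

lemma list_prod_append:
  "set xs \<subseteq> carrier G \<Longrightarrow> set ys \<subseteq> carrier G \<Longrightarrow>
     list_prod G (xs @ ys) = list_prod G xs \<otimes> list_prod G ys"
  by (induction xs) (auto simp: m_assoc)

lemma assoc_relI:
  assumes "a \<in> carrier G" "e \<in> Units G" "h \<in> Units G"
  shows "(a, e \<otimes> a \<otimes> h) \<in> assoc_rel G"
  using assms unfolding assoc_rel_def by auto

lemma assoc_relE:
  assumes "(a, b) \<in> assoc_rel G"
  obtains e h where "a \<in> carrier G" "b \<in> carrier G" "e \<in> Units G" "h \<in> Units G" "b = e \<otimes> a \<otimes> h"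
  using assms unfolding assoc_rel_def by auto

lemma assoc_rel_carrier: "assoc_rel G \<subseteq> carrier G \<times> carrier G"
  unfolding assoc_rel_def by auto

lemma assoc_rel_refl: "a \<in> carrier G \<Longrightarrow> (a, a) \<in> assoc_rel G"
  using assoc_relI[of a \<one> \<one>] by simp

lemma assoc_rel_sym: "(a, b) \<in> assoc_rel G \<Longrightarrow> (b, a) \<in> assoc_rel G"
proof (elim assoc_relE)
  fix e h assume *: "a \<in> carrier G" "b \<in> carrier G" "e \<in> Units G" "h \<in> Units G" "b = e \<otimes> a \<otimes> h"
  then have "inv e \<otimes> b \<otimes> inv h = (inv e \<otimes> e) \<otimes> a \<otimes> (h \<otimes> inv h)"
    by (simp add: m_assoc Units_closed del: Units_l_inv Units_r_inv)
  then have "inv e \<otimes> b \<otimes> inv h = a" using * by simp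
  then show ?thesis using assoc_relI[of b "inv e" "inv h"] * by simp
qed

lemma assoc_rel_trans: "(a, b) \<in> assoc_rel G \<Longrightarrow> (b, c) \<in> assoc_rel G \<Longrightarrow> (a, c) \<in> assoc_rel G"
proof (elim assoc_relE)
  fix e h e' h'
  assume *: "a \<in> carrier G" "e \<in> Units G" "h \<in> Units G" "b = e \<otimes> a \<otimes> h"
    "e' \<in> Units G" "h' \<in> Units G" "c = e' \<otimes> b \<otimes> h'"
  then have "c = (e' \<otimes> e) \<otimes> a \<otimes> (h \<otimes> h')"
    by (simp add: m_assoc Units_closed)
  then show ?thesis using assoc_relI[of a "e' \<otimes> e" "h \<otimes> h'"] * by simp
qed

lemma equiv_assoc_rel: "equiv (carrier G) (assoc_rel G)"
  by (intro equivI refl_onI symI transI assoc_rel_carrier)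
     (auto intro: assoc_rel_refl assoc_rel_sym assoc_rel_trans)

lemma assoc_rel_Units:
  assumes "a \<in> Units G" "b \<in> Units G"
  shows "(a, b) \<in> assoc_rel G"
  using assoc_relI[of a "b \<otimes> inv a" \<one>] assms by (simp add: m_assoc Units_closed)

lemma assoc_rel_in_Units: "(a, b) \<in> assoc_rel G \<Longrightarrow> a \<in> Units G \<longleftrightarrow> b \<in> Units G"
  by (metis (no_types, lifting) Units_m_closed assoc_relE assoc_rel_sym)

lemma atoms_carrier: "atoms G \<subseteq> carrier G"
  unfolding atoms_def by auto

lemma atoms_Units: "u \<in> atoms G \<Longrightarrow> u \<notin> Units G"
  unfolding atoms_def by auto

lemma atomsD:
  "a \<otimes> b \<in> atoms G \<Longrightarrow> a \<in> carrier G \<Longrightarrow> b \<in> carrier G \<Longrightarrow> a \<in> Units G \<or> b \<in> Units G"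
  unfolding atoms_def by auto

text \<open>Without commutativity, associativity need not be compatible with products, since a unit
  can get stuck between two factors. If the second factors are units, they are absorbed as outer
  units; this case suffices for products that are atoms.\<close>

lemma assoc_rel_mult_Units:
  assumes "(a, b) \<in> assoc_rel G" "e \<in> Units G" "h \<in> Units G"
  shows "(a \<otimes> e, b \<otimes> h) \<in> assoc_rel G" "(e \<otimes> a, h \<otimes> b) \<in> assoc_rel G"
proof -
  have [simp]: "a \<in> carrier G" "b \<in> carrier G" using assms(1) assoc_rel_carrier by auto
  have 1: "(x, x \<otimes> e) \<in> assoc_rel G" "(x, e \<otimes> x) \<in> assoc_rel G"
    if "x \<in> carrier G" "e \<in> Units G" for x e
    using assoc_relI[of x \<one> e] assoc_relI[of x e \<one>] that by (simp_all add: Units_closed)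
  show "(a \<otimes> e, b \<otimes> h) \<in> assoc_rel G" "(e \<otimes> a, h \<otimes> b) \<in> assoc_rel G"
    using 1[of a e] 1[of b h] assms by (simp_all) (meson assoc_rel_sym assoc_rel_trans)+
qed

text \<open>A factorization of \<open>v\<close> becomes one of \<open>u\<close> by absorbing the
  outer units into the two factors, and this does not affect which factors are units.\<close>

lemma atoms_assoc:
  assumes "u \<in> atoms G" "(u, v) \<in> assoc_rel G"
  shows "v \<in> atoms G"
proof -
  obtain e h where *: "u \<in> carrier G" "v \<in> carrier G" "e \<in> Units G" "h \<in> Units G" "u = e \<otimes> v \<otimes> h"
    using assoc_relE[OF assoc_rel_sym[OF assms(2)]] by metis
  have "a \<in> Units G \<or> b \<in> Units G" if ab: "a \<in> carrier G" "b \<in> carrier G" "v = a \<otimes> b" for a b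
  proof -
    have "u = (e \<otimes> a) \<otimes> (b \<otimes> h)" using * ab by (simp add: m_assoc Units_closed)
    then have "e \<otimes> a \<in> Units G \<or> b \<otimes> h \<in> Units G"
      using atomsD[of "e \<otimes> a" "b \<otimes> h"] assms(1) * ab by (simp add: Units_closed)
    moreover have "(a, e \<otimes> a) \<in> assoc_rel G" "(b, b \<otimes> h) \<in> assoc_rel G"
      using assoc_relI[of a e \<one>] assoc_relI[of b \<one> h] * ab by (simp_all add: Units_closed)
    ultimately show ?thesis using assoc_rel_in_Units by blast
  qed
  then show ?thesis
    using assms atoms_Units assoc_rel_in_Units * unfolding atoms_def by blast
qed

section \<open>The relation \<open>perm_rel\<close> and its transitive closure\<close>

abbreviation msim :: "'a list \<Rightarrow> 'a list \<Rightarrow> bool" where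
  "msim as bs \<equiv> rel_mset (\<lambda>x y. (x, y) \<in> assoc_rel G) (mset as) (mset bs)"

lemma msim_sym: "msim as bs \<Longrightarrow> msim bs as"
  by (subst multiset.rel_flip[symmetric]) (auto elim!: multiset.rel_mono_strong intro: assoc_rel_sym)

text \<open>Transitivity holds at the level of lists only. It does not carry over to
  \<open>perm_rel\<close>, where the middle element may occur with two unrelated
  factorizations.\<close>

lemma msim_trans: "msim as bs \<Longrightarrow> msim bs cs \<Longrightarrow> msim as cs"
proof -
  assume "msim as bs" "msim bs cs"
  then have "rel_mset ((\<lambda>x y. (x, y) \<in> assoc_rel G) OO (\<lambda>x y. (x, y) \<in> assoc_rel G)) (mset as) (mset cs)"
    by (auto simp: multiset.rel_compp)
  then show ?thesis by (rule multiset.rel_mono_strong) (auto intro: assoc_rel_trans)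
qed

lemma msim_list_all2: "list_all2 (\<lambda>x y. (x, y) \<in> assoc_rel G) as bs \<Longrightarrow> msim as bs"
  unfolding rel_mset_def by auto

lemma msim_refl: "set as \<subseteq> carrier G \<Longrightarrow> msim as as"
  by (rule msim_list_all2) (auto simp: list_all2_same intro: assoc_rel_refl)

lemma msim_length: "msim as bs \<Longrightarrow> length as = length bs"
  using rel_mset_size by fastforce

text \<open>All units are associated, so the outer units can be turned into two further factors.\<close>

lemma perm_rel_iff:
  "(a, b) \<in> perm_rel G \<longleftrightarrow> (\<exists>as bs. set as \<subseteq> carrier G \<and> set bs \<subseteq> carrier G \<and>
     a = list_prod G as \<and> b = list_prod G bs \<and> msim as bs)"
proof
  assume "(a, b) \<in> perm_rel G"
  then obtain as bs where *: "set as \<subseteq> carrier G" "set bs \<subseteq> carrier G"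
    "(a, list_prod G as) \<in> assoc_rel G" "(b, list_prod G bs) \<in> assoc_rel G" "msim as bs"
    unfolding perm_rel_def rel_mset_iff_permutes by blast
  obtain e h where a: "e \<in> Units G" "h \<in> Units G" "a = e \<otimes> list_prod G as \<otimes> h"
    using assoc_relE[OF assoc_rel_sym[OF *(3)]] by metis
  obtain e' h' where b: "e' \<in> Units G" "h' \<in> Units G" "b = e' \<otimes> list_prod G bs \<otimes> h'"
    using assoc_relE[OF assoc_rel_sym[OF *(4)]] by metis
  have "a = list_prod G (e # as @ [h])" "b = list_prod G (e' # bs @ [h'])"
    using a b * by (auto simp: list_prod_append m_assoc Units_closed)
  moreover have "msim (e # as @ [h]) (e' # bs @ [h'])"
  proof -
    have "msim [e, h] [e', h']"
      by (rule msim_list_all2) (use a b in \<open>auto intro: assoc_rel_Units\<close>)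
    from rel_mset_add[OF this *(5)] show ?thesis by simp
  qed
  ultimately show "\<exists>as bs. set as \<subseteq> carrier G \<and> set bs \<subseteq> carrier G \<and>
     a = list_prod G as \<and> b = list_prod G bs \<and> msim as bs"
    using a b * by (intro exI[of _ "e # as @ [h]"] exI[of _ "e' # bs @ [h']"]) (auto simp: Units_closed)
next
  assume "\<exists>as bs. set as \<subseteq> carrier G \<and> set bs \<subseteq> carrier G \<and>
     a = list_prod G as \<and> b = list_prod G bs \<and> msim as bs"
  then show "(a, b) \<in> perm_rel G"
    unfolding perm_rel_def rel_mset_iff_permutes
    by (smt (verit) assoc_rel_refl case_prodI list_prod_closed mem_Collect_eq)
qed

lemma perm_rel_carrier: "perm_rel G \<subseteq> carrier G \<times> carrier G"
  unfolding perm_rel_def by auto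

lemma perm_rel_assoc: "assoc_rel G \<subseteq> perm_rel G"
proof (clarify)
  fix a b assume *: "(a, b) \<in> assoc_rel G"
  then have "msim [a] [b]" by (intro msim_list_all2) simp
  moreover have "a \<in> carrier G" "b \<in> carrier G" using * assoc_rel_carrier by auto
  ultimately show "(a, b) \<in> perm_rel G"
    unfolding perm_rel_iff by (intro exI[of _ "[a]"] exI[of _ "[b]"]) auto
qed

lemma perm_rel_refl: "a \<in> carrier G \<Longrightarrow> (a, a) \<in> perm_rel G"
  using perm_rel_assoc assoc_rel_refl by auto

lemma perm_rel_sym: "(a, b) \<in> perm_rel G \<Longrightarrow> (b, a) \<in> perm_rel G"
  unfolding perm_rel_iff using msim_sym by metis

lemma perm_rel_mult:
  assumes "(a, b) \<in> perm_rel G" "(c, d) \<in> perm_rel G"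
  shows "(a \<otimes> c, b \<otimes> d) \<in> perm_rel G"
proof -
  obtain as bs where 1: "set as \<subseteq> carrier G" "set bs \<subseteq> carrier G"
     "a = list_prod G as" "b = list_prod G bs" "msim as bs"
    using assms(1) unfolding perm_rel_iff by blast
  obtain cs ds where 2: "set cs \<subseteq> carrier G" "set ds \<subseteq> carrier G"
     "c = list_prod G cs" "d = list_prod G ds" "msim cs ds"
    using assms(2) unfolding perm_rel_iff by blast
  have "msim (as @ cs) (bs @ ds)" using rel_mset_add[OF 1(5) 2(5)] by simp
  then show ?thesis unfolding perm_rel_iff using 1 2
    by (intro exI[of _ "as @ cs"] exI[of _ "bs @ ds"]) (auto simp: list_prod_append)
qed

lemma perm_rel_comm:
  assumes "a \<in> carrier G" "b \<in> carrier G"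
  shows "(a \<otimes> b, b \<otimes> a) \<in> perm_rel G"
proof -
  have "msim [a, b] [b, a]"
    using msim_refl[of "[a, b]"] assms by (simp add: add_mset_commute[of b a])
  then show ?thesis
    unfolding perm_rel_iff using assms by (intro exI[of _ "[a, b]"] exI[of _ "[b, a]"]) auto
qed

text \<open>A single step survives multiplication by a fixed element, because
  \<open>perm_rel\<close> is reflexive and compatible with products; induction extends this to
  chains, on each side separately.\<close>

lemma monoid_congruence_trancl_perm_rel: "monoid_congruence G ((perm_rel G)\<^sup>+)"
proof -
  let ?r = "(perm_rel G)\<^sup>+"
  have carr: "?r \<subseteq> carrier G \<times> carrier G"
    using perm_rel_carrier by (rule trancl_subset_Sigma)
  have left: "(c \<otimes> a, c \<otimes> b) \<in> ?r" if "(a, b) \<in> ?r" "c \<in> carrier G" for a b c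
    using that(1)
  proof induction
    case (base y)
    then show ?case using perm_rel_mult[OF perm_rel_refl[OF that(2)]] by blast
  next
    case (step y z)
    then show ?case using perm_rel_mult[OF perm_rel_refl[OF that(2)]] by (meson trancl.simps)
  qed
  have right: "(a \<otimes> c, b \<otimes> c) \<in> ?r" if "(a, b) \<in> ?r" "c \<in> carrier G" for a b c
    using that(1)
  proof induction
    case (base y)
    then show ?case using perm_rel_mult[OF _ perm_rel_refl[OF that(2)]] by blast
  next
    case (step y z)
    then show ?case using perm_rel_mult[OF _ perm_rel_refl[OF that(2)]] by (meson trancl.simps)
  qed
  have "equiv (carrier G) ?r"
    by (intro equivI refl_onI sym_trancl trans_trancl carr symI)
       (auto intro: perm_rel_refl perm_rel_sym)
  \<comment> \<open>The two chains may differ in length, so they are joined at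
    \<open>b \<otimes> c\<close>: first \<open>a\<close> is changed to \<open>b\<close>, then
    \<open>c\<close> to \<open>d\<close>.\<close>
  moreover have "(a \<otimes> c, b \<otimes> d) \<in> ?r" if "(a, b) \<in> ?r" "(c, d) \<in> ?r" for a b c d
    using left[OF that(2), of b] right[OF that(1), of c] carr that by (meson SigmaD1 SigmaD2 subsetD trancl_trans)
  ultimately show ?thesis unfolding monoid_congruence_def by blast
qed

text \<open>The head of \<open>as\<close> occurs somewhere in \<open>bs\<close> and can be moved to
  the front past the prefix \<open>l\<close> modulo \<open>r\<close>; the induction hypothesis
  treats the remaining factors.\<close>

lemma congruence_mset_eq:
  assumes r: "monoid_congruence G r"
    and comm: "\<And>a b. a \<in> carrier G \<Longrightarrow> b \<in> carrier G \<Longrightarrow> (a \<otimes> b, b \<otimes> a) \<in> r"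
    and "set as \<subseteq> carrier G" "mset as = mset bs"
  shows "(list_prod G as, list_prod G bs) \<in> r"
  using assms(3,4)
proof (induction as arbitrary: bs)
  case Nil
  then show ?case using monoid_congruenceD(1)[OF r] by (auto simp: refl_on_def)
next
  case (Cons x as)
  note D = monoid_congruenceD[OF r]
  have refl: "(a, a) \<in> r" if "a \<in> carrier G" for a using D(1) that by (auto simp: refl_on_def)
  have "x \<in> set bs" using Cons.prems(2) by (metis list.set_intros(1) set_mset_mset)
  then obtain l t where bs: "bs = l @ x # t" by (meson split_list)
  have lt: "mset as = mset (l @ t)" using Cons.prems(2) bs by simp
  have sub: "set l \<subseteq> carrier G" "set t \<subseteq> carrier G" "x \<in> carrier G"
    using Cons.prems bs by (metis set_mset_mset set_append le_sup_iff list.set(2) insert_subset)+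
  have "(list_prod G as, list_prod G l \<otimes> list_prod G t) \<in> r"
    using Cons.IH[OF _ lt] Cons.prems(1) sub by (simp add: list_prod_append)
  then have "(x \<otimes> list_prod G as, x \<otimes> (list_prod G l \<otimes> list_prod G t)) \<in> r"
    using D(5) refl sub(3) by blast
  moreover have "((x \<otimes> list_prod G l) \<otimes> list_prod G t, (list_prod G l \<otimes> x) \<otimes> list_prod G t) \<in> r"
    using D(5) refl comm sub by simp
  ultimately have "(x \<otimes> list_prod G as, list_prod G l \<otimes> (x \<otimes> list_prod G t)) \<in> r"
    using sub D(3) by (simp add: m_assoc) (meson transD)
  then show ?case using sub by (simp add: bs list_prod_append)
qed

text \<open>Both lists are first rearranged so that associated factors stand at equal positions,
  which costs only commutations; then the factors are exchanged one by one. Neither move leaves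
  \<open>r\<close>.\<close>

lemma perm_rel_subset_congruence:
  assumes r: "monoid_congruence G r"
    and comm: "\<And>a b. a \<in> carrier G \<Longrightarrow> b \<in> carrier G \<Longrightarrow> (a \<otimes> b, b \<otimes> a) \<in> r"
    and "assoc_rel G \<subseteq> r"
  shows "perm_rel G \<subseteq> r"
proof clarify
  fix a b assume "(a, b) \<in> perm_rel G"
  then obtain as bs where *: "set as \<subseteq> carrier G" "set bs \<subseteq> carrier G"
     "a = list_prod G as" "b = list_prod G bs" "msim as bs"
    unfolding perm_rel_iff by blast
  note D = monoid_congruenceD[OF r]
  obtain xs ys where xy: "mset xs = mset as" "mset ys = mset bs" "list_all2 (\<lambda>x y. (x, y) \<in> assoc_rel G) xs ys"
    using *(5) unfolding rel_mset_def by blast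
  have "(list_prod G xs, list_prod G ys) \<in> r"
    using xy(3)
  proof induction
    case Nil
    then show ?case using D(1) by (simp add: refl_on_def)
  next
    case (Cons x xs y ys)
    then show ?case using D(5) assms(3) by auto
  qed
  moreover have "(a, list_prod G xs) \<in> r"
    unfolding * by (rule congruence_mset_eq[OF r comm]) (use * xy in auto)
  moreover have "(list_prod G ys, b) \<in> r"
    unfolding * by (rule congruence_mset_eq[OF r comm]) (use * xy in \<open>auto dest: mset_eq_setD\<close>)
  ultimately show "(a, b) \<in> r" using D(3) by (meson transD)
qed

section \<open>Quotient monoids and the abelianization\<close>

text \<open>The union defining the product runs over a nonempty family whose members all coincide,
  since \<open>r\<close> is compatible with multiplication.\<close>

lemma quot_monoid_mult:
  assumes r: "monoid_congruence G r" and "a \<in> carrier G" "b \<in> carrier G"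
  shows "r `` {a} \<otimes>\<^bsub>quot_monoid G r\<^esub> r `` {b} = r `` {a \<otimes> b}"
proof -
  note D = monoid_congruenceD[OF r]
  have eq: "equiv (carrier G) r" using r unfolding monoid_congruence_def by auto
  have "r `` {x \<otimes> y} = r `` {a \<otimes> b}" if "(a, x) \<in> r" "(b, y) \<in> r" for x y
    using equiv_class_eq[OF eq D(5)[OF that]] by simp
  moreover have "a \<in> r `` {a}" "b \<in> r `` {b}" using D(1) assms by (auto simp: refl_on_def)
  ultimately have "(\<Union>x\<in>r `` {a}. \<Union>y\<in>r `` {b}. r `` {x \<otimes> y}) = r `` {a \<otimes> b}" by blast
  then show ?thesis unfolding quot_monoid_def by simp
qed

lemma quot_monoid_class_eq:
  assumes "monoid_congruence G r" "a \<in> carrier G" "b \<in> carrier G"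
  shows "r `` {a} = r `` {b} \<longleftrightarrow> (a, b) \<in> r"
  using assms eq_equiv_class_iff unfolding monoid_congruence_def by metis

lemma quot_monoid_carrier: "carrier (quot_monoid G r) = (\<lambda>a. r `` {a}) ` carrier G"
  unfolding quot_monoid_def quotient_def by auto

lemma quot_monoid_one: "\<one>\<^bsub>quot_monoid G r\<^esub> = r `` {\<one>}"
  unfolding quot_monoid_def by auto

lemma monoid_quot_monoid:
  assumes r: "monoid_congruence G r"
  shows "monoid (quot_monoid G r)"
  by (intro monoidI)
     (auto simp: quot_monoid_carrier quot_monoid_one quot_monoid_mult[OF r] m_assoc)

lemma ab_rel_subset:
  assumes "monoid_congruence G r"
    and "\<And>a b. a \<in> carrier G \<Longrightarrow> b \<in> carrier G \<Longrightarrow> (a \<otimes> b, b \<otimes> a) \<in> r"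
  shows "ab_rel G \<subseteq> r"
  unfolding ab_rel_def using assms by (intro Inter_lower) auto

lemma ab_rel_comm: "a \<in> carrier G \<Longrightarrow> b \<in> carrier G \<Longrightarrow> (a \<otimes> b, b \<otimes> a) \<in> ab_rel G"
  unfolding ab_rel_def by auto

lemma monoid_congruence_ab_rel: "monoid_congruence G (ab_rel G)"
proof -
  let ?C = "carrier G \<times> carrier G"
  \<comment> \<open>The full relation is a member of the intersected family; this confines the
    intersection to the carrier.\<close>
  have "monoid_congruence G ?C"
    unfolding monoid_congruence_def
    by (auto intro!: equivI refl_onI symI transI)
  then have "ab_rel G \<subseteq> ?C" by (rule ab_rel_subset) auto
  moreover have "refl_on (carrier G) (ab_rel G)"
    unfolding ab_rel_def by (auto simp: refl_on_def dest: monoid_congruenceD(1))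
  moreover have "sym (ab_rel G)"
    unfolding ab_rel_def by (intro symI) (auto dest: monoid_congruenceD(2) symD)
  moreover have "trans (ab_rel G)"
    unfolding ab_rel_def by (intro transI) (blast dest: monoid_congruenceD(3) transD)
  ultimately have "equiv (carrier G) (ab_rel G)" by (intro equivI)
  moreover have "\<forall>a b c d. (a, b) \<in> ab_rel G \<longrightarrow> (c, d) \<in> ab_rel G \<longrightarrow> (a \<otimes> c, b \<otimes> d) \<in> ab_rel G"
    unfolding ab_rel_def by (auto dest: monoid_congruenceD(5))
  ultimately show ?thesis unfolding monoid_congruence_def by blast
qed

lemma comm_monoid_ab_monoid: "comm_monoid (ab_monoid G)"
proof -
  note c = monoid_congruence_ab_rel
  interpret Q: monoid "ab_monoid G"
    unfolding ab_monoid_def by (rule monoid_quot_monoid[OF c])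
  have "ab_rel G `` {a \<otimes> b} = ab_rel G `` {b \<otimes> a}" if "a \<in> carrier G" "b \<in> carrier G" for a b
    using that quot_monoid_class_eq[OF c] ab_rel_comm by simp
  then show ?thesis
    by (intro Q.monoid_comm_monoidI)
       (auto simp: ab_monoid_def quot_monoid_carrier quot_monoid_mult[OF c])
qed

end

text \<open>Commutativity moves the units standing between the two factors to the outside. This
  makes the quotient of the abelianization by associativity meaningful.\<close>

lemma (in comm_monoid) monoid_congruence_assoc_rel: "monoid_congruence G (assoc_rel G)"
proof -
  have "(a \<otimes> c, b \<otimes> d) \<in> assoc_rel G" if ab: "(a, b) \<in> assoc_rel G" and cd: "(c, d) \<in> assoc_rel G" for a b c d
  proof -
    obtain e h where 1: "a \<in> carrier G" "e \<in> Units G" "h \<in> Units G" "b = e \<otimes> a \<otimes> h"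
      using assoc_relE[OF ab] by metis
    obtain e' h' where 2: "c \<in> carrier G" "e' \<in> Units G" "h' \<in> Units G" "d = e' \<otimes> c \<otimes> h'"
      using assoc_relE[OF cd] by metis
    have "b \<otimes> d = (e \<otimes> e') \<otimes> (a \<otimes> c) \<otimes> (h \<otimes> h')"
      using 1 2 by (simp add: m_ac Units_closed)
    then show ?thesis using assoc_relI[of "a \<otimes> c" "e \<otimes> e'" "h \<otimes> h'"] 1 2 by simp
  qed
  then show ?thesis unfolding monoid_congruence_def using equiv_assoc_rel by blast
qed

section \<open>The reduced abelianization and its canonical homomorphism\<close>

context monoid
begin

lemma ab_monoid_carrier: "carrier (ab_monoid G) = (\<lambda>a. ab_rel G `` {a}) ` carrier G"
  unfolding ab_monoid_def by (rule quot_monoid_carrier)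

lemma ab_monoid_mult:
  "a \<in> carrier G \<Longrightarrow> b \<in> carrier G \<Longrightarrow>
     ab_rel G `` {a} \<otimes>\<^bsub>ab_monoid G\<^esub> ab_rel G `` {b} = ab_rel G `` {a \<otimes> b}"
  unfolding ab_monoid_def by (rule quot_monoid_mult[OF monoid_congruence_ab_rel])

lemma ab_class_eq:
  "a \<in> carrier G \<Longrightarrow> b \<in> carrier G \<Longrightarrow> ab_rel G `` {a} = ab_rel G `` {b} \<longleftrightarrow> (a, b) \<in> ab_rel G"
  by (rule quot_monoid_class_eq[OF monoid_congruence_ab_rel])

lemma ab_class_Units:
  assumes "e \<in> Units G"
  shows "ab_rel G `` {e} \<in> Units (ab_monoid G)"
proof -
  have "ab_rel G `` {inv e} \<in> carrier (ab_monoid G)" "ab_rel G `` {e} \<in> carrier (ab_monoid G)"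
    using assms by (auto simp: ab_monoid_carrier Units_closed)
  moreover have "\<one>\<^bsub>ab_monoid G\<^esub> = ab_rel G `` {\<one>}"
    by (simp add: ab_monoid_def quot_monoid_one)
  ultimately show ?thesis
    unfolding Units_def using assms by (auto simp: ab_monoid_mult Units_closed intro!: bexI[of _ "ab_rel G `` {inv e}"])
qed

lemma rab_carrier: "carrier (rab_monoid G) = rab_proj G ` carrier G"
proof -
  interpret A: comm_monoid "ab_monoid G" by (rule comm_monoid_ab_monoid)
  show ?thesis
    unfolding rab_monoid_def rab_proj_def A.quot_monoid_carrier ab_monoid_carrier by auto
qed

lemma monoid_rab_monoid: "monoid (rab_monoid G)"
proof -
  interpret A: comm_monoid "ab_monoid G" by (rule comm_monoid_ab_monoid)
  show ?thesis
    unfolding rab_monoid_def by (rule A.monoid_quot_monoid[OF A.monoid_congruence_assoc_rel])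
qed

lemma rab_proj_mult:
  assumes "a \<in> carrier G" "b \<in> carrier G"
  shows "rab_proj G (a \<otimes> b) = rab_proj G a \<otimes>\<^bsub>rab_monoid G\<^esub> rab_proj G b"
proof -
  interpret A: comm_monoid "ab_monoid G" by (rule comm_monoid_ab_monoid)
  show ?thesis
    using assms unfolding rab_monoid_def rab_proj_def
    by (subst A.quot_monoid_mult[OF A.monoid_congruence_assoc_rel]) (auto simp: ab_monoid_carrier ab_monoid_mult)
qed

lemma rab_proj_one: "rab_proj G \<one> = \<one>\<^bsub>rab_monoid G\<^esub>"
  unfolding rab_monoid_def rab_proj_def quot_monoid_def ab_monoid_def by simp

text \<open>Replaces equality of classes of classes by associativity in the abelianization, where
  the units involved become visible.\<close>

lemma rab_rel_iff:
  "(a, b) \<in> rab_rel G \<longleftrightarrow> a \<in> carrier G \<and> b \<in> carrier G \<and>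
     (ab_rel G `` {a}, ab_rel G `` {b}) \<in> assoc_rel (ab_monoid G)"
proof -
  interpret A: comm_monoid "ab_monoid G" by (rule comm_monoid_ab_monoid)
  have "rab_proj G a = rab_proj G b \<longleftrightarrow>
      (ab_rel G `` {a}, ab_rel G `` {b}) \<in> assoc_rel (ab_monoid G)"
    if "a \<in> carrier G" "b \<in> carrier G"
    unfolding rab_proj_def using that
    by (intro A.quot_monoid_class_eq[OF A.monoid_congruence_assoc_rel]) (auto simp: ab_monoid_carrier)
  then show ?thesis unfolding rab_rel_def by blast
qed

lemma rab_rel_proj: "a \<in> carrier G \<Longrightarrow> b \<in> carrier G \<Longrightarrow> rab_proj G a = rab_proj G b \<longleftrightarrow> (a, b) \<in> rab_rel G"
  unfolding rab_rel_def by auto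

lemma monoid_congruence_rab_rel: "monoid_congruence G (rab_rel G)"
proof -
  have "equiv (carrier G) (rab_rel G)"
    unfolding rab_rel_def by (auto intro!: equivI refl_onI symI transI)
  moreover have "(a \<otimes> c, b \<otimes> d) \<in> rab_rel G" if "(a, b) \<in> rab_rel G" "(c, d) \<in> rab_rel G" for a b c d
    using that unfolding rab_rel_def by (auto simp: rab_proj_mult)
  ultimately show ?thesis unfolding monoid_congruence_def by blast
qed

lemma ab_rel_subset_rab_rel: "ab_rel G \<subseteq> rab_rel G"
proof clarify
  interpret A: comm_monoid "ab_monoid G" by (rule comm_monoid_ab_monoid)
  fix a b assume *: "(a, b) \<in> ab_rel G"
  then have "a \<in> carrier G" "b \<in> carrier G"
    using monoid_congruenceD(4)[OF monoid_congruence_ab_rel] by auto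
  then show "(a, b) \<in> rab_rel G"
    unfolding rab_rel_iff using * ab_class_eq[of a b] A.assoc_rel_refl by (auto simp: ab_monoid_carrier)
qed

lemma assoc_rel_subset_rab_rel: "assoc_rel G \<subseteq> rab_rel G"
proof clarify
  interpret A: comm_monoid "ab_monoid G" by (rule comm_monoid_ab_monoid)
  fix a b assume "(a, b) \<in> assoc_rel G"
  then obtain e h where *: "a \<in> carrier G" "b \<in> carrier G" "e \<in> Units G" "h \<in> Units G" "b = e \<otimes> a \<otimes> h"
    by (rule assoc_relE)
  then show "(a, b) \<in> rab_rel G"
    unfolding rab_rel_iff
    using A.assoc_relI[of "ab_rel G `` {a}" "ab_rel G `` {e}" "ab_rel G `` {h}"] ab_class_Units
    by (simp add: ab_monoid_mult Units_closed ab_monoid_carrier)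
qed

text \<open>\<open>rab_rel\<close> is a congruence that contains associativity and all pairs
  \<open>(ab, ba)\<close>, so it contains \<open>perm_rel\<close>; being transitive, it absorbs
  chains.\<close>

lemma trancl_perm_rel_subset_rab_rel: "(perm_rel G)\<^sup>+ \<subseteq> rab_rel G"
proof -
  have "perm_rel G \<subseteq> rab_rel G"
    using perm_rel_subset_congruence[OF monoid_congruence_rab_rel _ assoc_rel_subset_rab_rel]
      ab_rel_comm ab_rel_subset_rab_rel by blast
  then show ?thesis
    using monoid_congruenceD(3)[OF monoid_congruence_rab_rel] trancl_id trancl_mono_subset by metis
qed

lemma rab_proj_list_prod:
  "set us \<subseteq> carrier G \<Longrightarrow> rab_proj G (list_prod G us) = list_prod (rab_monoid G) (map (rab_proj G) us)"
  by (induction us) (auto simp: list_prod_def[of "rab_monoid G"] rab_proj_mult rab_proj_one)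

text \<open>With \<open>us = []\<close> the claim would fail: a nontrivial unit is associated to the empty product.\<close>

lemma assoc_list_prod_absorb:
  assumes "(a, list_prod G us) \<in> assoc_rel G" "set us \<subseteq> carrier G" "us \<noteq> []"
  obtains us' where "a = list_prod G us'" "list_all2 (\<lambda>x y. (x, y) \<in> assoc_rel G) us us'"
proof -
  obtain e h where *: "e \<in> Units G" "h \<in> Units G" "a = e \<otimes> list_prod G us \<otimes> h"
    using assoc_relE[OF assoc_rel_sym[OF assms(1)]] by metis
  obtain x xs where us: "us = x # xs" using assms(3) by (cases us) auto
  show thesis
  proof (cases xs rule: rev_cases)
    case Nil
    then show ?thesis
      using that[of "[e \<otimes> x \<otimes> h]"] assoc_relI[of x e h] assms(2) * us by (auto simp: Units_closed)
  next
    case (snoc ys y)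
    have "list_all2 (\<lambda>x y. (x, y) \<in> assoc_rel G) us ((e \<otimes> x) # ys @ [y \<otimes> h])"
      using assoc_relI[of x e \<one>] assoc_relI[of y \<one> h] assms(2) * unfolding us snoc
      by (auto simp: Units_closed list_all2_same intro!: list_all2_appendI assoc_rel_refl)
    moreover have "a = list_prod G ((e \<otimes> x) # ys @ [y \<otimes> h])"
      using assms(2) * unfolding us snoc by (auto simp: Units_closed list_prod_append m_assoc)
    ultimately show ?thesis using that by blast
  qed
qed

end

section \<open>Units and atoms in the cancellative case\<close>

context monoid_cancel
begin

text \<open>An inverse \<open>w\<close> of the product gives \<open>a\<close> the right inverse
  \<open>b \<otimes> w\<close> and \<open>b\<close> the left inverse \<open>w \<otimes> a\<close>;
  cancellation makes both of them two-sided.\<close>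

lemma Units_factors:
  assumes "a \<otimes> b \<in> Units G" "a \<in> carrier G" "b \<in> carrier G"
  shows "a \<in> Units G" "b \<in> Units G"
proof -
  define w where "w = inv (a \<otimes> b)"
  have w: "w \<in> carrier G" "(a \<otimes> b) \<otimes> w = \<one>" "w \<otimes> (a \<otimes> b) = \<one>"
    unfolding w_def using assms by auto
  have a: "a \<otimes> (b \<otimes> w) = \<one>" and b: "(w \<otimes> a) \<otimes> b = \<one>" using w assms by (simp_all add: m_assoc)
  have "a \<otimes> ((b \<otimes> w) \<otimes> a) = a \<otimes> \<one>" using a assms w by (simp add: m_assoc[symmetric])
  then have a': "(b \<otimes> w) \<otimes> a = \<one>" using assms w by (metis l_cancel m_closed one_closed)
  have "(b \<otimes> (w \<otimes> a)) \<otimes> b = \<one> \<otimes> b" using b assms w by (simp add: m_assoc)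
  then have b': "b \<otimes> (w \<otimes> a) = \<one>" using assms w by (metis r_cancel m_closed one_closed)
  show "a \<in> Units G"
    unfolding Units_def using a a' assms w by (auto intro!: bexI[of _ "b \<otimes> w"])
  show "b \<in> Units G"
    unfolding Units_def using b b' assms w by (auto intro!: bexI[of _ "w \<otimes> a"])
qed

lemma Units_mult_iff: "a \<in> carrier G \<Longrightarrow> b \<in> carrier G \<Longrightarrow> a \<otimes> b \<in> Units G \<longleftrightarrow> a \<in> Units G \<and> b \<in> Units G"
  using Units_factors Units_m_closed by blast

lemma atoms_mult:
  assumes "a \<otimes> b \<in> atoms G" "a \<in> carrier G" "b \<in> carrier G"
  shows "a \<in> Units G \<and> b \<in> atoms G \<or> a \<in> atoms G \<and> b \<in> Units G"
proof -
  have 1: "(x, x \<otimes> e) \<in> assoc_rel G" "(x, e \<otimes> x) \<in> assoc_rel G"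
    if "x \<in> carrier G" "e \<in> Units G" for x e
    using assoc_relI[of x \<one> e] assoc_relI[of x e \<one>] that by (simp_all add: Units_closed)
  show ?thesis
    using atomsD[OF assms] 1 assms assoc_rel_sym atoms_assoc by meson
qed

text \<open>A coarse congruence built for the minimality argument. Its classes are the group of
  units, the associativity classes of atoms, and a single class of all remaining elements.\<close>

definition atom_rel :: "('a \<times> 'a) set" where
  "atom_rel = {(a, b). a \<in> carrier G \<and> b \<in> carrier G \<and> (a \<in> Units G \<longleftrightarrow> b \<in> Units G) \<and>
     (a \<in> atoms G \<or> b \<in> atoms G \<longrightarrow> (a, b) \<in> assoc_rel G)}"

lemma assoc_rel_subset_atom_rel: "assoc_rel G \<subseteq> atom_rel"
proof (rule subrelI)
  fix a b assume ab: "(a, b) \<in> assoc_rel G"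
  then have "a \<in> carrier G" "b \<in> carrier G" using assoc_rel_carrier by auto
  then show "(a, b) \<in> atom_rel" unfolding atom_rel_def using ab assoc_rel_in_Units[OF ab] by simp
qed

text \<open>If one of the products is an atom, then \<open>a\<close> or \<open>b\<close> is a unit,
  and conjugation by this unit turns one product into the other.\<close>

lemma atom_rel_comm:
  assumes "a \<in> carrier G" "b \<in> carrier G"
  shows "(a \<otimes> b, b \<otimes> a) \<in> atom_rel"
proof -
  have *: "(a \<otimes> b, b \<otimes> a) \<in> assoc_rel G" if "a \<in> carrier G" "b \<in> Units G" for a b
    using assoc_relI[of "a \<otimes> b" b "inv b"] that by (simp add: m_assoc Units_closed)
  have "(a \<otimes> b, b \<otimes> a) \<in> assoc_rel G" if "a \<otimes> b \<in> atoms G \<or> b \<otimes> a \<in> atoms G"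
    using that *[of a b] *[of b a] assms atoms_mult assoc_rel_sym by blast
  then show ?thesis unfolding atom_rel_def using assms by (auto simp: Units_mult_iff)
qed

text \<open>An atom splits only into a unit and an atom, and the relation replaces these by a unit
  and an associated atom. For units, compatibility is the fact that a product is a unit exactly if
  both factors are.\<close>

lemma monoid_congruence_atom_rel: "monoid_congruence G atom_rel"
proof -
  have sym: "(b, a) \<in> atom_rel" if "(a, b) \<in> atom_rel" for a b
    using that unfolding atom_rel_def by (auto intro: assoc_rel_sym)
  \<comment> \<open>If an outer element is an atom, the middle one is associated to it and hence an
    atom as well, so both links are associations.\<close>
  have tr: "(a, c) \<in> atom_rel" if "(a, b) \<in> atom_rel" "(b, c) \<in> atom_rel" for a b c
  proof -
    have "(a, c) \<in> assoc_rel G" if "a \<in> atoms G \<or> c \<in> atoms G"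
    proof -
      have "b \<in> atoms G"
        using that \<open>(a, b) \<in> atom_rel\<close> \<open>(b, c) \<in> atom_rel\<close> atoms_assoc assoc_rel_sym
        unfolding atom_rel_def by blast
      then show ?thesis
        using \<open>(a, b) \<in> atom_rel\<close> \<open>(b, c) \<in> atom_rel\<close> assoc_rel_trans unfolding atom_rel_def by blast
    qed
    then show ?thesis using that unfolding atom_rel_def by blast
  qed
  have eq: "equiv (carrier G) atom_rel"
  proof (intro equivI refl_onI symI transI)
    show "atom_rel \<subseteq> carrier G \<times> carrier G" unfolding atom_rel_def by blast
    show "(a, a) \<in> atom_rel" if "a \<in> carrier G" for a
      using that assoc_rel_refl unfolding atom_rel_def by simp
  qed (fact sym, fact tr)
  have one: "(a \<otimes> c, b \<otimes> d) \<in> assoc_rel G"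
    if "(a, b) \<in> atom_rel" "(c, d) \<in> atom_rel" "a \<otimes> c \<in> atoms G" for a b c d
  proof -
    have "a \<in> Units G \<and> c \<in> atoms G \<or> a \<in> atoms G \<and> c \<in> Units G"
      using that atoms_mult[of a c] unfolding atom_rel_def by simp
    then show ?thesis
    proof (elim disjE conjE)
      assume "a \<in> Units G" "c \<in> atoms G"
      then have "b \<in> Units G" "(c, d) \<in> assoc_rel G" using that unfolding atom_rel_def by simp_all
      then show ?thesis using \<open>a \<in> Units G\<close> by (intro assoc_rel_mult_Units)
    next
      assume "a \<in> atoms G" "c \<in> Units G"
      then have "d \<in> Units G" "(a, b) \<in> assoc_rel G" using that unfolding atom_rel_def by simp_all
      then show ?thesis using \<open>c \<in> Units G\<close> by (intro assoc_rel_mult_Units)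
    qed
  qed
  have "(a \<otimes> c, b \<otimes> d) \<in> atom_rel" if *: "(a, b) \<in> atom_rel" "(c, d) \<in> atom_rel" for a b c d
  proof -
    have "(a \<otimes> c, b \<otimes> d) \<in> assoc_rel G" if "a \<otimes> c \<in> atoms G \<or> b \<otimes> d \<in> atoms G"
      using that one[OF *] one[OF sym[OF *(1)] sym[OF *(2)]] assoc_rel_sym by blast
    then show ?thesis using * unfolding atom_rel_def by (simp add: Units_mult_iff)
  qed
  with eq show ?thesis unfolding monoid_congruence_def by blast
qed

section \<open>Minimality of \<open>rab_rel\<close>\<close>

text \<open>Invertibility of the class of \<open>a\<close> makes some \<open>a \<otimes> b\<close>
  congruent to the neutral element. As \<open>ab_rel\<close> lies inside \<open>atom_rel\<close>,
  this product is a unit of \<open>G\<close>, and so is its factor \<open>a\<close>.\<close>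

lemma ab_class_UnitsD:
  assumes "A \<in> Units (ab_monoid G)"
  obtains e where "e \<in> Units G" "A = ab_rel G `` {e}"
proof -
  interpret A: comm_monoid "ab_monoid G" by (rule comm_monoid_ab_monoid)
  obtain a where a: "a \<in> carrier G" "A = ab_rel G `` {a}"
    using A.Units_closed[OF assms] by (auto simp: ab_monoid_carrier)
  obtain B where "B \<in> carrier (ab_monoid G)" "A \<otimes>\<^bsub>ab_monoid G\<^esub> B = \<one>\<^bsub>ab_monoid G\<^esub>"
    using assms unfolding Units_def by auto
  then obtain b where b: "b \<in> carrier G" "ab_rel G `` {a \<otimes> b} = ab_rel G `` {\<one>}"
    using a by (auto simp: ab_monoid_carrier ab_monoid_mult) (simp add: ab_monoid_def quot_monoid_one)
  then have "(a \<otimes> b, \<one>) \<in> ab_rel G" using a ab_class_eq by simp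
  then have "(a \<otimes> b, \<one>) \<in> atom_rel"
    using ab_rel_subset[OF monoid_congruence_atom_rel atom_rel_comm] by blast
  then have "a \<in> Units G" unfolding atom_rel_def using a b by (auto simp: Units_mult_iff)
  then show thesis using that a by blast
qed

text \<open>Associativity in the abelianization uses units \<open>E\<close>, \<open>H\<close> there,
  and these lift to units \<open>e\<close>, \<open>h\<close> of \<open>G\<close>. So
  \<open>a\<close> reaches \<open>b\<close> by one association, to
  \<open>e \<otimes> a \<otimes> h\<close>, followed by one \<open>ab_rel\<close> step.\<close>

lemma rab_rel_subset:
  assumes r: "monoid_congruence G r"
    and comm: "\<And>a b. a \<in> carrier G \<Longrightarrow> b \<in> carrier G \<Longrightarrow> (a \<otimes> b, b \<otimes> a) \<in> r"
    and "assoc_rel G \<subseteq> r"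
  shows "rab_rel G \<subseteq> r"
proof clarify
  interpret A: comm_monoid "ab_monoid G" by (rule comm_monoid_ab_monoid)
  fix a b assume "(a, b) \<in> rab_rel G"
  then have ab: "a \<in> carrier G" "b \<in> carrier G"
    "(ab_rel G `` {a}, ab_rel G `` {b}) \<in> assoc_rel (ab_monoid G)"
    unfolding rab_rel_iff by auto
  from A.assoc_relE[OF ab(3)] obtain E H where EH: "E \<in> Units (ab_monoid G)" "H \<in> Units (ab_monoid G)"
    "ab_rel G `` {b} = E \<otimes>\<^bsub>ab_monoid G\<^esub> ab_rel G `` {a} \<otimes>\<^bsub>ab_monoid G\<^esub> H" by metis
  obtain e where e: "e \<in> Units G" "E = ab_rel G `` {e}" using ab_class_UnitsD EH(1) by metis
  obtain h where h: "h \<in> Units G" "H = ab_rel G `` {h}" using ab_class_UnitsD EH(2) by metis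
  have "ab_rel G `` {b} = ab_rel G `` {e \<otimes> a \<otimes> h}"
    using EH(3) e h ab by (simp add: ab_monoid_mult Units_closed)
  then have "(e \<otimes> a \<otimes> h, b) \<in> ab_rel G" using ab_class_eq[of "e \<otimes> a \<otimes> h" b] e h ab by (simp add: Units_closed)
  then have "(e \<otimes> a \<otimes> h, b) \<in> r" using ab_rel_subset[OF r comm] by blast
  moreover have "(a, e \<otimes> a \<otimes> h) \<in> r" using assms(3) assoc_relI[OF ab(1) e(1) h(1)] by blast
  ultimately show "(a, b) \<in> r" using monoid_congruenceD(3)[OF r] by (meson transD)
qed

text \<open>Opens \<open>rab_rel\<close> to induction along chains of \<open>perm_rel\<close>
  steps.\<close>

lemma rab_rel_eq_trancl: "rab_rel G = (perm_rel G)\<^sup>+"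
proof
  show "rab_rel G \<subseteq> (perm_rel G)\<^sup>+"
    by (rule rab_rel_subset[OF monoid_congruence_trancl_perm_rel])
       (use perm_rel_comm perm_rel_assoc in auto)
qed (rule trancl_perm_rel_subset_rab_rel)

lemma rab_rel_subset_atom_rel: "rab_rel G \<subseteq> atom_rel"
  by (rule rab_rel_subset[OF monoid_congruence_atom_rel atom_rel_comm assoc_rel_subset_atom_rel])

lemma rab_rel_Units: "(a, b) \<in> rab_rel G \<Longrightarrow> a \<in> Units G \<longleftrightarrow> b \<in> Units G"
  by (drule subsetD[OF rab_rel_subset_atom_rel]) (simp add: atom_rel_def)

lemma rab_rel_atoms: "(a, b) \<in> rab_rel G \<Longrightarrow> a \<in> atoms G \<or> b \<in> atoms G \<Longrightarrow> (a, b) \<in> assoc_rel G"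
  by (drule subsetD[OF rab_rel_subset_atom_rel]) (auto simp: atom_rel_def)

section \<open>Units and atoms of the reduced abelianization\<close>

text \<open>An inverse pair lifts to a product related to the neutral element. Its factors are then
  units of \<open>G\<close>, and all units are associated to the neutral element. Consequently
  associativity in the quotient is equality.\<close>

lemma Units_rab_monoid: "Units (rab_monoid G) = {\<one>\<^bsub>rab_monoid G\<^esub>}"
proof -
  interpret R: monoid "rab_monoid G" by (rule monoid_rab_monoid)
  have "A = \<one>\<^bsub>rab_monoid G\<^esub>" if A: "A \<in> Units (rab_monoid G)" for A
  proof -
    obtain a where a: "a \<in> carrier G" "A = rab_proj G a"
      using R.Units_closed[OF A] by (auto simp: rab_carrier)
    obtain b where b: "b \<in> carrier G" "inv\<^bsub>rab_monoid G\<^esub> A = rab_proj G b"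
      using R.Units_inv_closed[OF A] by (auto simp: rab_carrier)
    have "rab_proj G (a \<otimes> b) = rab_proj G \<one>"
      using R.Units_r_inv[OF A] a b by (simp add: rab_proj_mult rab_proj_one)
    then have "(a \<otimes> b, \<one>) \<in> rab_rel G" using a b by (simp add: rab_rel_proj)
    then have "a \<in> Units G" using rab_rel_Units[of "a \<otimes> b" \<one>] a b by (simp add: Units_mult_iff)
    then have "(a, \<one>) \<in> rab_rel G" using assoc_rel_Units[of a \<one>] assoc_rel_subset_rab_rel by auto
    then show ?thesis using a rab_rel_proj[of a \<one>] rab_proj_one by simp
  qed
  then show ?thesis using R.Units_one_closed by blast
qed

lemma assoc_rel_rab_monoid: "assoc_rel (rab_monoid G) = Id_on (carrier (rab_monoid G))"
proof -
  interpret R: monoid "rab_monoid G" by (rule monoid_rab_monoid)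
  show ?thesis unfolding assoc_rel_def Units_rab_monoid by auto
qed

lemma rab_proj_Units: "a \<in> carrier G \<Longrightarrow> rab_proj G a \<in> Units (rab_monoid G) \<longleftrightarrow> a \<in> Units G"
  unfolding Units_rab_monoid using rab_rel_Units[of a \<one>] assoc_rel_Units[of a \<one>] assoc_rel_subset_rab_rel
  by (auto simp: rab_proj_one[symmetric] rab_rel_proj)

text \<open>A factorization in \<open>G\<close> can be projected, with units preserved and
  reflected. Conversely, a factorization of the image lifts to a product
  \<open>b \<otimes> c\<close> related to \<open>a\<close>; since \<open>a\<close> is an atom, that
  product is associated to it and is an atom too.\<close>

lemma rab_proj_atoms:
  assumes a: "a \<in> carrier G"
  shows "rab_proj G a \<in> atoms (rab_monoid G) \<longleftrightarrow> a \<in> atoms G"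
proof
  assume *: "rab_proj G a \<in> atoms (rab_monoid G)"
  have "b \<in> Units G \<or> c \<in> Units G" if "b \<in> carrier G" "c \<in> carrier G" "a = b \<otimes> c" for b c
    using * that rab_proj_mult rab_proj_Units unfolding atoms_def rab_carrier by blast
  then show "a \<in> atoms G" using * a rab_proj_Units unfolding atoms_def by blast
next
  assume *: "a \<in> atoms G"
  have "b \<in> Units G \<or> c \<in> Units G"
    if bc: "b \<in> carrier G" "c \<in> carrier G" "rab_proj G a = rab_proj G (b \<otimes> c)" for b c
  proof -
    have "(a, b \<otimes> c) \<in> assoc_rel G" using bc a * rab_rel_atoms by (simp add: rab_rel_proj)
    then have "b \<otimes> c \<in> atoms G" using * atoms_assoc by blast
    then show ?thesis using bc atomsD by blast
  qed
  then show "rab_proj G a \<in> atoms (rab_monoid G)"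
    using * a rab_proj_Units unfolding atoms_def
    by (auto simp: rab_carrier rab_proj_mult[symmetric])
qed

text \<open>Associated images are equal images, so the two atoms are related by
  \<open>rab_rel\<close>, which on atoms is no coarser than associativity.\<close>

lemma isoatomic_rab_proj:
  assumes "monoid_cancel (rab_monoid G)"
  shows "isoatomic G (rab_monoid G) (rab_proj G)"
proof -
  have "(u, v) \<in> assoc_rel G"
    if "u \<in> atoms G" "v \<in> atoms G" "(rab_proj G u, rab_proj G v) \<in> assoc_rel (rab_monoid G)" for u v
    using that rab_rel_atoms[of u v] atoms_carrier
    by (auto simp: assoc_rel_rab_monoid Id_on_iff rab_rel_proj subset_iff)
  moreover have "monoid_hom G (rab_monoid G) (rab_proj G)"
    unfolding monoid_hom_def by (auto simp: rab_proj_one rab_proj_mult rab_carrier intro!: homI)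
  ultimately show ?thesis
    unfolding isoatomic_def using assms monoid_cancel_axioms by blast
qed

section \<open>Transport of factorizations and the weak transfer property\<close>

text \<open>Condition (1) of the theorem, with the permutation absorbed into
  \<open>msim\<close>.\<close>

definition permutable_factorizations :: bool where
  "permutable_factorizations \<longleftrightarrow>
     (\<forall>a b us. (a, b) \<in> perm_rel G \<longrightarrow> set us \<subseteq> atoms G \<longrightarrow> (a, list_prod G us) \<in> assoc_rel G \<longrightarrow>
        (\<exists>vs. set vs \<subseteq> atoms G \<and> (b, list_prod G vs) \<in> assoc_rel G \<and> msim us vs))"

text \<open>Condition (1) is applied along a chain of \<open>perm_rel\<close> steps: the atoms found
  at one element are the input for the next, and \<open>msim_trans\<close> composes the
  comparisons.\<close>

lemma permutable_factorizations_rab_rel: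
  assumes "permutable_factorizations" "(a, b) \<in> rab_rel G" "set us \<subseteq> atoms G"
    "(a, list_prod G us) \<in> assoc_rel G"
  obtains vs where "set vs \<subseteq> atoms G" "(b, list_prod G vs) \<in> assoc_rel G" "msim us vs"
proof -
  have "(a, b) \<in> (perm_rel G)\<^sup>+" using assms(2) rab_rel_eq_trancl by simp
  then have "\<exists>vs. set vs \<subseteq> atoms G \<and> (b, list_prod G vs) \<in> assoc_rel G \<and> msim us vs"
  proof induction
    case (base y)
    then show ?case using assms unfolding permutable_factorizations_def by blast
  next
    case (step y z)
    then obtain vs where vs: "set vs \<subseteq> atoms G" "(y, list_prod G vs) \<in> assoc_rel G" "msim us vs" by blast
    then obtain ws where "set ws \<subseteq> atoms G" "(z, list_prod G ws) \<in> assoc_rel G" "msim vs ws"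
      using assms(1) step(2) unfolding permutable_factorizations_def by blast
    then show ?case using vs(3) msim_trans by blast
  qed
  then show thesis using that by blast
qed

lemma atoms_list_lift:
  assumes "set vs \<subseteq> atoms (rab_monoid G)"
  obtains ws where "set ws \<subseteq> atoms G" "map (rab_proj G) ws = vs"
  using assms
proof (induction vs arbitrary: thesis)
  case (Cons v vs)
  obtain ws where ws: "set ws \<subseteq> atoms G" "map (rab_proj G) ws = vs" using Cons by auto
  have "v \<in> carrier (rab_monoid G)" using Cons.prems(2) unfolding atoms_def by auto
  then obtain w where "w \<in> carrier G" "v = rab_proj G w" by (auto simp: rab_carrier)
  then show ?case using Cons.prems ws rab_proj_atoms by (intro Cons.prems(1)[of "w # ws"]) auto
qed auto

text \<open>This is (WT2). The atoms \<open>vs\<close> are lifted to atoms \<open>ws\<close> of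
  \<open>G\<close>, whose product has the same image as \<open>a\<close>; transport along
  \<open>rab_rel\<close> carries this factorization over to \<open>a\<close>.\<close>

lemma permutable_factorizations_lift:
  assumes C: "permutable_factorizations" and a: "a \<in> carrier G"
    and vs: "vs \<noteq> []" "set vs \<subseteq> atoms (rab_monoid G)" "rab_proj G a = list_prod (rab_monoid G) vs"
  obtains us where "set us \<subseteq> atoms G" "a = list_prod G us"
    "rel_mset (\<lambda>u v. (rab_proj G u, v) \<in> assoc_rel (rab_monoid G)) (mset us) (mset vs)"
proof -
  obtain ws where ws: "set ws \<subseteq> atoms G" "map (rab_proj G) ws = vs"
    using atoms_list_lift[OF vs(2)] .
  have wc: "set ws \<subseteq> carrier G" using ws atoms_carrier by auto
  have "(list_prod G ws, a) \<in> rab_rel G"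
    using rab_proj_list_prod[OF wc] ws vs(3) a wc rab_rel_proj[of "list_prod G ws" a] by simp
  then obtain us where us: "set us \<subseteq> atoms G" "(a, list_prod G us) \<in> assoc_rel G" "msim ws us"
    using permutable_factorizations_rab_rel[OF C _ ws(1)] assoc_rel_refl wc by (metis list_prod_closed)
  \<comment> \<open>Transport yields a product only associated to \<open>a\<close>, while (WT2)
    demands equality; the outer units go into the factors, of which there must be at least
    one.\<close>
  have "us \<noteq> []" using msim_length[OF us(3)] vs(1) ws by auto
  moreover have uc: "set us \<subseteq> carrier G" using us atoms_carrier by auto
  ultimately obtain us' where us': "a = list_prod G us'" "list_all2 (\<lambda>x y. (x, y) \<in> assoc_rel G) us us'"
    using assoc_list_prod_absorb[OF us(2)] by blast
  have "set us' \<subseteq> atoms G"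
    using us'(2) us(1) by (induction) (auto intro: atoms_assoc)
  moreover have sim: "msim us' ws"
    using us(3) msim_list_all2[OF us'(2)] msim_trans msim_sym by blast
  \<comment> \<open>Associated elements have equal images, so the comparison with \<open>ws\<close>
    in \<open>G\<close> projects to one with \<open>vs\<close>.\<close>
  have "rel_mset (\<lambda>u v. (rab_proj G u, v) \<in> assoc_rel (rab_monoid G)) (mset us')
      (image_mset (rab_proj G) (mset ws))"
    unfolding multiset.rel_map
    by (rule multiset.rel_mono_strong[OF sim])
       (use assoc_rel_subset_rab_rel in \<open>auto simp: assoc_rel_rab_monoid rab_rel_def rab_carrier Id_on_iff\<close>)
  then have "rel_mset (\<lambda>u v. (rab_proj G u, v) \<in> assoc_rel (rab_monoid G)) (mset us') (mset vs)"
    using ws(2) by auto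
  ultimately show thesis using that us' by blast
qed

lemma weak_transfer_hom_rab_proj_iff:
  assumes cancel: "monoid_cancel (rab_monoid G)" and atomic: "atomic (rab_monoid G)"
  shows "weak_transfer_hom G (rab_monoid G) (rab_proj G) \<longleftrightarrow> permutable_factorizations"
proof
  assume W: "weak_transfer_hom G (rab_monoid G) (rab_proj G)"
  have lift: "\<exists>us. set us \<subseteq> atoms G \<and> a = list_prod G us \<and>
       rel_mset (\<lambda>u v. (rab_proj G u, v) \<in> assoc_rel (rab_monoid G)) (mset us) (mset vs)"
    if "a \<in> carrier G" "vs \<noteq> []" "set vs \<subseteq> atoms (rab_monoid G)" "rab_proj G a = list_prod (rab_monoid G) vs" for a vs
  proof -
    have "\<exists>us \<sigma>. length us = length vs \<and> set us \<subseteq> atoms G \<and> \<sigma> permutes {..<length vs} \<and>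
           a = list_prod G us \<and>
           (\<forall>i<length vs. (rab_proj G (us ! i), vs ! \<sigma> i) \<in> assoc_rel (rab_monoid G))"
      using W that unfolding weak_transfer_hom_def by blast
    then show ?thesis unfolding rel_mset_iff_permutes by metis
  qed
  show permutable_factorizations
    unfolding permutable_factorizations_def
  proof (intro allI impI)
    fix a b us
    assume ab: "(a, b) \<in> perm_rel G" and us: "set us \<subseteq> atoms G" "(a, list_prod G us) \<in> assoc_rel G"
    have uc: "set us \<subseteq> carrier G" using us atoms_carrier by auto
    have rab: "(a, b) \<in> rab_rel G" using ab rab_rel_eq_trancl by auto
    have carr: "a \<in> carrier G" "b \<in> carrier G" using ab perm_rel_carrier by auto
    show "\<exists>vs. set vs \<subseteq> atoms G \<and> (b, list_prod G vs) \<in> assoc_rel G \<and> msim us vs"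
    proof (cases "us = []")
      \<comment> \<open>(WT2) concerns nonempty products only. Here \<open>a\<close> is a unit, so
        \<open>b\<close> is one too and is associated to the empty product.\<close>
      case True
      then have "b \<in> Units G"
        using us(2) assoc_rel_in_Units[of a \<one>] rab_rel_Units[OF rab] by simp
      then show ?thesis
        using True assoc_rel_Units[of b \<one>] msim_refl[of "[]"] by (intro exI[of _ "[]"]) auto
    next
      case False
      have atoms_us: "set (map (rab_proj G) us) \<subseteq> atoms (rab_monoid G)"
        using us(1) uc rab_proj_atoms by auto
      have "rab_proj G b = rab_proj G (list_prod G us)"
        using us(2) assoc_rel_subset_rab_rel rab unfolding rab_rel_def by auto
      also have "\<dots> = list_prod (rab_monoid G) (map (rab_proj G) us)" by (rule rab_proj_list_prod[OF uc])
      \<comment> \<open>(WT2) is applied to \<open>b\<close>, with the images of the atoms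
        \<open>us\<close> of \<open>a\<close> as the prescribed factors.\<close>
      finally obtain vs where vs: "set vs \<subseteq> atoms G" "b = list_prod G vs"
        "rel_mset (\<lambda>u v. (rab_proj G u, v) \<in> assoc_rel (rab_monoid G)) (mset vs) (mset (map (rab_proj G) us))"
        using lift[OF carr(2), of "map (rab_proj G) us"] False atoms_us by auto
      have "rel_mset (\<lambda>u v. (rab_proj G u, rab_proj G v) \<in> assoc_rel (rab_monoid G)) (mset vs) (mset us)"
        using vs(3) by (simp add: multiset.rel_map)
      \<comment> \<open>Being isoatomic pulls the association of images back to the atoms
        themselves.\<close>
      then have "msim vs us"
        by (rule multiset.rel_mono_strong)
           (use isoatomic_rab_proj[OF cancel] vs us in \<open>auto simp: isoatomic_def\<close>)
      then show ?thesis using vs carr assoc_rel_refl msim_sym by blast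
    qed
  qed
next
  assume C: permutable_factorizations
  have hom: "monoid_hom G (rab_monoid G) (rab_proj G)"
    using isoatomic_rab_proj[OF cancel] unfolding isoatomic_def by blast
  interpret R: monoid "rab_monoid G" by (rule monoid_rab_monoid)
  \<comment> \<open>With only the trivial unit in the target, this part of (T1) is the surjectivity
    of the projection.\<close>
  have surj: "carrier (rab_monoid G) = {\<epsilon> \<otimes>\<^bsub>rab_monoid G\<^esub> rab_proj G s \<otimes>\<^bsub>rab_monoid G\<^esub> \<eta> | \<epsilon> s \<eta>.
      \<epsilon> \<in> Units (rab_monoid G) \<and> s \<in> carrier G \<and> \<eta> \<in> Units (rab_monoid G)}"
    unfolding Units_rab_monoid by (force simp: rab_carrier)
  have units: "{a \<in> carrier G. rab_proj G a \<in> Units (rab_monoid G)} = Units G"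
    using rab_proj_Units Units_closed by blast
  have "\<exists>us \<sigma>. length us = length vs \<and> set us \<subseteq> atoms G \<and> \<sigma> permutes {..<length vs} \<and>
           a = list_prod G us \<and>
           (\<forall>i<length vs. (rab_proj G (us ! i), vs ! \<sigma> i) \<in> assoc_rel (rab_monoid G))"
    if a: "a \<in> carrier G" and vs: "vs \<noteq> [] \<and> set vs \<subseteq> atoms (rab_monoid G) \<and> rab_proj G a = list_prod (rab_monoid G) vs"
    for a vs
  proof -
    obtain us where "set us \<subseteq> atoms G" "a = list_prod G us"
      "rel_mset (\<lambda>u v. (rab_proj G u, v) \<in> assoc_rel (rab_monoid G)) (mset us) (mset vs)"
      using permutable_factorizations_lift[OF C a] vs by blast
    then show ?thesis unfolding rel_mset_iff_permutes by metis
  qed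
  then show "weak_transfer_hom G (rab_monoid G) (rab_proj G)"
    unfolding weak_transfer_hom_def
    using monoid_cancel_axioms cancel atomic hom surj units by blast
qed

text \<open>Atomicity factors the image of a non-unit \<open>a\<close>; the factorization lifts to
  \<open>a\<close> and is transported to \<open>b\<close>. The two resulting lists of atoms witness
  \<open>perm_rel\<close> directly, so a whole chain collapses to one step.\<close>

lemma permutable_factorizations_imp_perm_rel_eq:
  assumes C: "permutable_factorizations" and atomic: "atomic (rab_monoid G)"
  shows "perm_rel G = rab_rel G"
proof
  show "perm_rel G \<subseteq> rab_rel G" using rab_rel_eq_trancl by auto
  show "rab_rel G \<subseteq> perm_rel G"
  proof clarify
    fix a b assume ab: "(a, b) \<in> rab_rel G"
    then have carr: "a \<in> carrier G" "b \<in> carrier G" unfolding rab_rel_def by auto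
    show "(a, b) \<in> perm_rel G"
    proof (cases "a \<in> Units G")
      \<comment> \<open>Atomicity provides factorizations of non-units only; units are associated to
        each other anyway.\<close>
      case True
      then show ?thesis using rab_rel_Units[OF ab] assoc_rel_Units perm_rel_assoc by blast
    next
      case False
      then have "rab_proj G a \<in> carrier (rab_monoid G) - Units (rab_monoid G)"
        using carr rab_proj_Units by (auto simp: rab_carrier)
      then obtain vs where vs: "set vs \<subseteq> atoms (rab_monoid G)" "rab_proj G a = list_prod (rab_monoid G) vs"
        using atomic unfolding atomic_def by blast
      \<comment> \<open>An empty product would make the image of \<open>a\<close>, and hence
        \<open>a\<close>, a unit.\<close>
      have "vs \<noteq> []"
        using vs(2) False carr rab_proj_Units Units_rab_monoid by (auto simp: list_prod_def)
      then obtain us where us: "set us \<subseteq> atoms G" "a = list_prod G us"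
        using permutable_factorizations_lift[OF C carr(1) _ vs] by blast
      then obtain ws where ws: "set ws \<subseteq> atoms G" "(b, list_prod G ws) \<in> assoc_rel G" "msim us ws"
        using permutable_factorizations_rab_rel[OF C ab] assoc_rel_refl carr by metis
      have "set us \<subseteq> carrier G" "set ws \<subseteq> carrier G" using us ws atoms_carrier by auto
      then show ?thesis
        using ws us carr assoc_rel_refl unfolding perm_rel_def rel_mset_iff_permutes by blast
    qed
  qed
qed

text \<open>A relation is transitive exactly if it equals its transitive closure, which here is
  \<open>rab_rel\<close>.\<close>

lemma trans_perm_rel_iff: "trans (perm_rel G) \<longleftrightarrow> perm_rel G = rab_rel G"
  using rab_rel_eq_trancl trancl_id trans_trancl by metis

lemma monoid_congruence_perm_rel_iff: "monoid_congruence G (perm_rel G) \<longleftrightarrow> perm_rel G = rab_rel G"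
  using trans_perm_rel_iff monoid_congruenceD(3) monoid_congruence_rab_rel by metis

end

text \<open>Weak transfer homomorphisms are defined for atomic targets, hence the premise on
  \<open>rab_monoid S\<close>. Condition (1) does not supply it: the nonnegative rationals under
  addition have no atoms and satisfy (1), but their reduced abelianization is not atomic.\<close>

theorem proposition6p7:
  fixes S :: "('a, 'b) monoid_scheme"
  assumes "monoid_cancel S"
    and "monoid_cancel (rab_monoid S)"
  defines "C1 \<equiv>
      (\<forall>a b us. (a, b) \<in> perm_rel S \<and> set us \<subseteq> atoms S \<and> (a, list_prod S us) \<in> assoc_rel S \<longrightarrow>
        (\<exists>vs \<sigma>. length vs = length us \<and> set vs \<subseteq> atoms S \<and> \<sigma> permutes {..<length us} \<and>
           (b, list_prod S vs) \<in> assoc_rel S \<and>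
           (\<forall>i<length us. (us ! i, vs ! \<sigma> i) \<in> assoc_rel S)))"
    and "C2 \<equiv> weak_transfer_hom S (rab_monoid S) (rab_proj S)"
    and "C3 \<equiv> isoatomic S (rab_monoid S) (rab_proj S) \<and>
               weak_transfer_hom S (rab_monoid S) (rab_proj S)"
    and "D1 \<equiv> trans (perm_rel S)"
    and "D2 \<equiv> monoid_congruence S (perm_rel S)"
    and "D3 \<equiv> perm_rel S = rab_rel S"
  shows "(atomic (rab_monoid S) \<longrightarrow>
            (C1 \<longleftrightarrow> C2) \<and> (C2 \<longleftrightarrow> C3) \<and> (C1 \<or> C2 \<or> C3 \<longrightarrow> D1 \<and> D2 \<and> D3)) \<and>
         (D1 \<longleftrightarrow> D2) \<and> (D2 \<longleftrightarrow> D3)"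
proof -
  interpret S: monoid_cancel S by (rule assms(1))
  have C1: "C1 \<longleftrightarrow> S.permutable_factorizations"
    unfolding C1_def S.permutable_factorizations_def rel_mset_iff_permutes by (simp only: imp_conjL) meson
  have C23: "C2 \<longleftrightarrow> C3"
    unfolding C2_def C3_def using S.isoatomic_rab_proj[OF assms(2)] by blast
  have D: "D1 \<longleftrightarrow> D2" "D2 \<longleftrightarrow> D3"
    unfolding D1_def D2_def D3_def
    using S.trans_perm_rel_iff S.monoid_congruence_perm_rel_iff by blast+
  have "C1 \<longleftrightarrow> C2" "C1 \<longrightarrow> D3" if "atomic (rab_monoid S)"
    using S.weak_transfer_hom_rab_proj_iff[OF assms(2) that]
      S.permutable_factorizations_imp_perm_rel_eq[OF _ that] C1
    unfolding C2_def D3_def by blast+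
  then show ?thesis using C23 D by blast
qed

end
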